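(* For any infinite cardinal $\lambda$ there exists a Hausdorff zero-dimensional semitopological semilattice $X$ such that $|X|=\lambda$ and $\bar\Lambda(X)=\bar\psi(X)=\mathrm{cf}(\lambda)$.
   Context: A semilattice is a commutative semigroup all of whose elements are idempotents. A topologized semilattice is a semilattice endowed with a topology; it is semitopological if its operation $(x,y)\mapsto xy$ is separately continuous. A topological space is zero-dimensional if it has a base of the topology consisting of open-and-closed sets. A closed neighborhood of a point $x$ is a closed set containing $x$ in its interior. For a Hausdorff topologized semilattice $X$: the Lawson number $\bar\Lambda(X)$ is the smallest cardinal $\kappa$ such that for any distinct points $x,y\in X$ there exists a family $\mathcal U$ of closed neighborhoods of $x$ such that $|\mathcal U|\le\kappa$ and $\bigcap\mathcal U$ is a subsemilattice of $X$ that does not contain $y$; the closed pseudocharacter $\bar\psi(X)$ is the smallest cardinal $\kappa$ such that for any point $x\in X$ there exists a family $\mathcal U$ of closed neighborhoods of $x$ such that $|\mathcal U|\le\kappa$ and $\bigcap\mathcal U=\{x\}$. $\mathrm{cf}(\lambda)$ denotes the cofinality of $\lambda$. *)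

theory Defs
  imports "HOL-Analysis.Analysis"
begin

unbundle cardinal_syntax
no_notation Set_Algebras.elt_set_eq (infix "=o" 50)

text \<open>
  As in the HOL library, a cardinal is a relation \<open>\<kappa>\<close> with \<open>Card_order \<kappa>\<close>, considered up to
  \<open>=o\<close>. The least cardinal with a property is accordingly determined up to \<open>=o\<close>. It ranges over
  the cardinals carried by one type; the lemmas below show that, in each use, this type is
  large enough to attain the minimum over cardinals of arbitrary type.
\<close>

definition least_cardinal :: "('k rel \<Rightarrow> bool) \<Rightarrow> 'k rel" where
  "least_cardinal P = (SOME \<kappa>. Card_order \<kappa> \<and> P \<kappa> \<and> (\<forall>\<kappa>'. Card_order \<kappa>' \<and> P \<kappa>' \<longrightarrow> \<kappa> \<le>o \<kappa>'))"

lemma least_cardinal: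
  assumes "Card_order \<kappa>" "P \<kappa>"
  shows "Card_order (least_cardinal P)" "P (least_cardinal P)" "least_cardinal P \<le>o \<kappa>"
proof -
  have "\<exists>\<mu>\<in>{\<mu>. Card_order \<mu> \<and> P \<mu>}. \<forall>\<kappa>'\<in>{\<mu>. Card_order \<mu> \<and> P \<mu>}. \<mu> \<le>o \<kappa>'"
    by (rule exists_minim_Card_order) (use assms in auto)
  then have "\<exists>\<mu>. Card_order \<mu> \<and> P \<mu> \<and> (\<forall>\<kappa>'. Card_order \<kappa>' \<and> P \<kappa>' \<longrightarrow> \<mu> \<le>o \<kappa>')"
    by auto
  from someI_ex[OF this]
  have *: "Card_order (least_cardinal P) \<and> P (least_cardinal P) \<and>
    (\<forall>\<kappa>'. Card_order \<kappa>' \<and> P \<kappa>' \<longrightarrow> least_cardinal P \<le>o \<kappa>')"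
    unfolding least_cardinal_def .
  from * assms show "Card_order (least_cardinal P)" "P (least_cardinal P)"
    "least_cardinal P \<le>o \<kappa>"
    by blast+
qed

text \<open>
  The library predicate \<open>cofinal\<close> asks for strict upper bounds. A limit ordinal, such as an
  infinite cardinal, has no largest element, so this is the usual notion.
\<close>

definition cofinality :: "'a rel \<Rightarrow> 'a rel" where
  "cofinality r = least_cardinal (\<lambda>\<kappa>. \<exists>K\<subseteq>Field r. cofinal K r \<and> |K| =o \<kappa>)"

definition semilattice_on :: "'a set \<Rightarrow> ('a \<Rightarrow> 'a \<Rightarrow> 'a) \<Rightarrow> bool" where
  "semilattice_on X m \<longleftrightarrow>
     (\<forall>x\<in>X. \<forall>y\<in>X. m x y \<in> X) \<and>
     (\<forall>x\<in>X. \<forall>y\<in>X. \<forall>z\<in>X. m (m x y) z = m x (m y z)) \<and>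
     (\<forall>x\<in>X. \<forall>y\<in>X. m x y = m y x) \<and>
     (\<forall>x\<in>X. m x x = x)"

definition subsemilattice :: "'a set \<Rightarrow> 'a set \<Rightarrow> ('a \<Rightarrow> 'a \<Rightarrow> 'a) \<Rightarrow> bool" where
  "subsemilattice S X m \<longleftrightarrow> S \<subseteq> X \<and> (\<forall>x\<in>S. \<forall>y\<in>S. m x y \<in> S)"

definition semitopological_semilattice :: "'a topology \<Rightarrow> ('a \<Rightarrow> 'a \<Rightarrow> 'a) \<Rightarrow> bool" where
  "semitopological_semilattice T m \<longleftrightarrow>
     semilattice_on (topspace T) m \<and>
     (\<forall>a\<in>topspace T. continuous_map T T (\<lambda>x. m a x) \<and> continuous_map T T (\<lambda>x. m x a))"

definition zero_dimensional_space :: "'a topology \<Rightarrow> bool" where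
  "zero_dimensional_space T \<longleftrightarrow>
     (\<exists>\<B>. (\<forall>B\<in>\<B>. openin T B \<and> closedin T B) \<and> openin T = arbitrary union_of (\<lambda>B. B \<in> \<B>))"

definition closed_nbhd :: "'a topology \<Rightarrow> 'a \<Rightarrow> 'a set \<Rightarrow> bool" where
  "closed_nbhd T x U \<longleftrightarrow> closedin T U \<and> x \<in> T interior_of U"

text \<open>
  Intersecting with \<open>topspace T\<close> makes the intersection of the empty family the whole space.
\<close>

definition Lawson_le :: "'a topology \<Rightarrow> ('a \<Rightarrow> 'a \<Rightarrow> 'a) \<Rightarrow> 'k rel \<Rightarrow> bool" where
  "Lawson_le T m \<kappa> \<longleftrightarrow>
     (\<forall>x\<in>topspace T. \<forall>y\<in>topspace T. x \<noteq> y \<longrightarrow>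
        (\<exists>\<U>. (\<forall>U\<in>\<U>. closed_nbhd T x U) \<and> |\<U>| \<le>o \<kappa> \<and>
             subsemilattice (topspace T \<inter> \<Inter>\<U>) (topspace T) m \<and> y \<notin> topspace T \<inter> \<Inter>\<U>))"

definition Lawson_number :: "'a topology \<Rightarrow> ('a \<Rightarrow> 'a \<Rightarrow> 'a) \<Rightarrow> 'a rel" where
  "Lawson_number T m = least_cardinal (Lawson_le T m)"

definition closed_pseudocharacter_le :: "'a topology \<Rightarrow> 'k rel \<Rightarrow> bool" where
  "closed_pseudocharacter_le T \<kappa> \<longleftrightarrow>
     (\<forall>x\<in>topspace T.
        \<exists>\<U>. (\<forall>U\<in>\<U>. closed_nbhd T x U) \<and> |\<U>| \<le>o \<kappa> \<and> topspace T \<inter> \<Inter>\<U> = {x})"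

definition closed_pseudocharacter :: "'a topology \<Rightarrow> 'a rel" where
  "closed_pseudocharacter T = least_cardinal (closed_pseudocharacter_le T)"


lemma cofinality:
  fixes r :: "'a rel"
  assumes "Cinfinite r"
  shows "Card_order (cofinality r)"
    and "\<exists>K\<subseteq>Field r. cofinal K r \<and> |K| =o cofinality r"
    and "\<And>K. K \<subseteq> Field r \<Longrightarrow> cofinal K r \<Longrightarrow> cofinality r \<le>o |K|"
proof -
  let ?P = "\<lambda>\<kappa>::'a rel. \<exists>K\<subseteq>Field r. cofinal K r \<and> |K| =o \<kappa>"
  have "cofinal (Field r) r"
    unfolding cofinal_def using assms infinite_Card_order_limit[of r]
    by (meson cinfinite_def)
  then have "?P |Field r|"
    by (intro exI[of _ "Field r"]) (auto intro: card_of_refl)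
  from least_cardinal[of "|Field r|" ?P, OF card_of_Card_order this]
  show "Card_order (cofinality r)" "?P (cofinality r)"
    unfolding cofinality_def by auto
  fix K assume "K \<subseteq> Field r" "cofinal K r"
  then have "?P |K|"
    by (intro exI[of _ K]) (auto intro: card_of_refl)
  from least_cardinal(3)[of "|K|" ?P, OF card_of_Card_order this]
  show "cofinality r \<le>o |K|" unfolding cofinality_def .
qed

lemma Hausdorff_closed_pseudocharacter_le:
  assumes "Hausdorff_space T"
  shows "closed_pseudocharacter_le T |topspace T|"
  unfolding closed_pseudocharacter_le_def
proof
  fix x assume x: "x \<in> topspace T"
  have "\<exists>U. closed_nbhd T x U \<and> y \<notin> U" if y: "y \<in> topspace T" "y \<noteq> x" for y
  proof -
    obtain A B where "openin T A" "openin T B" "x \<in> A" "y \<in> B" "disjnt A B"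
      using assms x y unfolding Hausdorff_space_def by metis
    moreover have "A \<subseteq> T interior_of (topspace T - B)"
      by (rule interior_of_maximal)
        (use \<open>openin T A\<close> \<open>disjnt A B\<close> openin_subset in \<open>auto simp: disjnt_def\<close>)
    ultimately show ?thesis
      by (intro exI[of _ "topspace T - B"]) (auto simp: closed_nbhd_def)
  qed
  then obtain U where U: "\<And>y. y \<in> topspace T \<Longrightarrow> y \<noteq> x \<Longrightarrow> closed_nbhd T x (U y) \<and> y \<notin> U y"
    by metis
  have "x \<in> U y" if "y \<in> topspace T" "y \<noteq> x" for y
    using U[OF that] interior_of_subset[of T "U y"] by (auto simp: closed_nbhd_def)
  then have "topspace T \<inter> \<Inter>(U ` (topspace T - {x})) = {x}"
    using x U by auto
  moreover have "|U ` (topspace T - {x})| \<le>o |topspace T|"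
    by (rule ordLeq_transitive[OF card_of_image card_of_mono1]) auto
  ultimately show "\<exists>\<U>. (\<forall>U\<in>\<U>. closed_nbhd T x U) \<and> |\<U>| \<le>o |topspace T| \<and>
      topspace T \<inter> \<Inter>\<U> = {x}"
    using U by (intro exI[of _ "U ` (topspace T - {x})"]) auto
qed

lemma closed_pseudocharacter_le_imp_Lawson_le:
  assumes "semilattice_on (topspace T) m" "closed_pseudocharacter_le T \<kappa>"
  shows "Lawson_le T m \<kappa>"
  unfolding Lawson_le_def
proof (intro ballI impI)
  fix x y assume xy: "x \<in> topspace T" "y \<in> topspace T" "x \<noteq> y"
  then obtain \<U> where U: "\<forall>U\<in>\<U>. closed_nbhd T x U" "|\<U>| \<le>o \<kappa>" "topspace T \<inter> \<Inter>\<U> = {x}"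
    using assms(2) unfolding closed_pseudocharacter_le_def by blast
  have "subsemilattice {x} (topspace T) m"
    using assms(1) xy(1) by (auto simp: subsemilattice_def semilattice_on_def)
  with U xy show "\<exists>\<U>. (\<forall>U\<in>\<U>. closed_nbhd T x U) \<and> |\<U>| \<le>o \<kappa> \<and>
      subsemilattice (topspace T \<inter> \<Inter>\<U>) (topspace T) m \<and> y \<notin> topspace T \<inter> \<Inter>\<U>"
    by (intro exI[of _ \<U>]) auto
qed

lemma cardinal_in_type:
  fixes \<kappa> :: "'b rel" and A :: "'a set"
  assumes "Card_order \<kappa>"
  shows "|A| \<le>o \<kappa> \<or> (\<exists>\<mu>::'a rel. Card_order \<mu> \<and> \<mu> =o \<kappa>)"
proof (cases "|A| \<le>o \<kappa>")
  case False
  then have "\<kappa> \<le>o |A|"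
    using assms ordLeq_total[of "|A|" \<kappa>] card_of_Well_order
    by (auto simp: card_order_on_def)
  then have "|Field \<kappa>| \<le>o |A|"
    using assms card_of_Field_ordIso ordIso_ordLeq_trans by blast
  then obtain f where f: "inj_on f (Field \<kappa>)" "f ` Field \<kappa> \<subseteq> A"
    using card_of_ordLeq[of "Field \<kappa>" A] by auto
  have "|f ` Field \<kappa>| =o |Field \<kappa>|"
    by (rule ordIso_symmetric[OF card_of_ordIsoI[OF inj_on_imp_bij_betw[OF f(1)]]])
  then have "|f ` Field \<kappa>| =o \<kappa>"
    using assms card_of_Field_ordIso ordIso_transitive by blast
  then show ?thesis using card_of_Card_order by blast
qed auto

lemma closed_pseudocharacter:
  assumes "Hausdorff_space T"
  shows "Card_order (closed_pseudocharacter T)"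
    and "closed_pseudocharacter_le T (closed_pseudocharacter T)"
    and "\<And>\<kappa> :: 'b rel. Card_order \<kappa> \<Longrightarrow> closed_pseudocharacter_le T \<kappa> \<Longrightarrow>
           closed_pseudocharacter T \<le>o \<kappa>"
proof -
  note * = least_cardinal[where P = "closed_pseudocharacter_le T"]
  note X = *[OF card_of_Card_order Hausdorff_closed_pseudocharacter_le[OF assms]]
  show "Card_order (closed_pseudocharacter T)"
    "closed_pseudocharacter_le T (closed_pseudocharacter T)"
    using X unfolding closed_pseudocharacter_def by auto
  fix \<kappa> :: "'b rel" assume \<kappa>: "Card_order \<kappa>" "closed_pseudocharacter_le T \<kappa>"
  from cardinal_in_type[OF \<kappa>(1), of "topspace T"]
  show "closed_pseudocharacter T \<le>o \<kappa>"
  proof (elim disjE exE conjE)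
    assume "|topspace T| \<le>o \<kappa>"
    then show ?thesis
      using X(3) ordLeq_transitive unfolding closed_pseudocharacter_def by blast
  next
    fix \<mu> :: "'a rel" assume \<mu>: "Card_order \<mu>" "\<mu> =o \<kappa>"
    have eq: "\<And>\<U> :: 'a set set. |\<U>| \<le>o \<kappa> \<longleftrightarrow> |\<U>| \<le>o \<mu>"
      using ordLeq_ordIso_trans[OF _ \<mu>(2)] ordLeq_ordIso_trans[OF _ ordIso_symmetric[OF \<mu>(2)]]
      by (intro iffI)
    have "closed_pseudocharacter_le T \<mu>"
      using \<kappa>(2) eq unfolding closed_pseudocharacter_le_def by simp
    from *(3)[OF \<mu>(1) this] \<mu>(2) show ?thesis
      using ordLeq_ordIso_trans unfolding closed_pseudocharacter_def by blast
  qed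
qed

lemma Lawson_number:
  assumes "Hausdorff_space T" "semilattice_on (topspace T) m"
  shows "Card_order (Lawson_number T m)"
    and "Lawson_le T m (Lawson_number T m)"
    and "\<And>\<kappa> :: 'b rel. Card_order \<kappa> \<Longrightarrow> Lawson_le T m \<kappa> \<Longrightarrow> Lawson_number T m \<le>o \<kappa>"
proof -
  note * = least_cardinal[where P = "Lawson_le T m"]
  note X = *[OF card_of_Card_order closed_pseudocharacter_le_imp_Lawson_le[OF assms(2)
        Hausdorff_closed_pseudocharacter_le[OF assms(1)]]]
  show "Card_order (Lawson_number T m)" "Lawson_le T m (Lawson_number T m)"
    using X unfolding Lawson_number_def by auto
  fix \<kappa> :: "'b rel" assume \<kappa>: "Card_order \<kappa>" "Lawson_le T m \<kappa>"
  from cardinal_in_type[OF \<kappa>(1), of "topspace T"]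
  show "Lawson_number T m \<le>o \<kappa>"
  proof (elim disjE exE conjE)
    assume "|topspace T| \<le>o \<kappa>"
    then show ?thesis
      using X(3) ordLeq_transitive unfolding Lawson_number_def by blast
  next
    fix \<mu> :: "'a rel" assume \<mu>: "Card_order \<mu>" "\<mu> =o \<kappa>"
    have eq: "\<And>\<U> :: 'a set set. |\<U>| \<le>o \<kappa> \<longleftrightarrow> |\<U>| \<le>o \<mu>"
      using ordLeq_ordIso_trans[OF _ \<mu>(2)] ordLeq_ordIso_trans[OF _ ordIso_symmetric[OF \<mu>(2)]]
      by (intro iffI)
    have "Lawson_le T m \<mu>"
      using \<kappa>(2) eq unfolding Lawson_le_def by simp
    from *(3)[OF \<mu>(1) this] \<mu>(2) show ?thesis
      using ordLeq_ordIso_trans unfolding Lawson_number_def by blast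
  qed
qed

end

theory Submission
  imports Defs
begin

text \<open>
  Write \<open>\<lambda>\<close> for the cardinal \<open>r\<close> and \<open>\<kappa>\<close> for its cofinality. The points of the semilattice are
  the finite partial functions from \<open>\<lambda>\<close> to \<open>{0,1}\<close> together with a zero element; the product
  of two partial functions is their union if they are compatible and zero otherwise. There
  are \<open>\<lambda>\<close> many such points. The sets of all points having the same restriction to
  \<open>{\<xi>. \<xi> \<le> \<alpha>}\<close> as a given partial function, with \<open>\<alpha> < \<lambda>\<close>, together with the singleton of
  zero, form a base of the topology. For a fixed
  \<open>\<alpha>\<close> they partition the space, so they are clopen and the topology is Hausdorff and
  zero-dimensional. Letting \<open>\<alpha>\<close> run through a cofinal subset of \<open>\<lambda>\<close> of size \<open>\<kappa>\<close> separates
  a point from all others, which bounds the closed pseudocharacter by \<open>\<kappa>\<close>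
  (\<open>trace_space.closed_pseudocharacter_le_cofinality\<close>).

  Translation by \<open>h\<close> is continuous at \<open>f\<close> because a point that agrees with \<open>f\<close> up to a bound of
  the domains of \<open>f\<close> and \<open>h\<close> extends \<open>f\<close> only outside the domain of \<open>h\<close>, so it is compatible
  with \<open>h\<close> exactly when \<open>f\<close> is. The operation is badly discontinuous jointly:
  fewer than \<open>\<kappa>\<close> neighbourhoods of the empty function all contain both functions with domain
  \<open>{\<gamma>}\<close>, for some large \<open>\<gamma>\<close>, and their product is zero. Hence an intersection of fewer than
  \<open>\<kappa>\<close> neighbourhoods of the empty function that is a subsemilattice contains zero, and the
  Lawson number is at least \<open>\<kappa>\<close> (\<open>partial_function_semilattice.cofinality_le_Lawson\<close>). It never
  exceeds the closed pseudocharacter, so both numbers are \<open>\<kappa>\<close>.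
\<close>

section \<open>Cofinality and bounded subsets\<close>

lemma Cinfinite_greater_exists:
  assumes "Cinfinite r" "a \<in> Field r"
  obtains b where "b \<in> Field r" "a \<noteq> b" "(a, b) \<in> r"
  using assms infinite_Card_order_limit[of r a] unfolding cinfinite_def by blast

lemma Cinfinite_linear_order:
  assumes "Cinfinite r"
  shows "Linear_order r"
  using assms by (simp add: card_order_on_def well_order_on_def)

lemma small_subset_bounded:
  assumes r: "Cinfinite r" and K: "K \<subseteq> Field r" and small: "|K| <o cofinality r"
  obtains b where "b \<in> Field r" "\<And>k. k \<in> K \<Longrightarrow> (k, b) \<in> r"
proof -
  have "\<not> cofinal K r"
    using cofinality(3)[OF r K] small not_ordLess_ordLeq by blast
  then obtain b where b: "b \<in> Field r" "\<And>k. k \<in> K \<Longrightarrow> \<not> (b \<noteq> k \<and> (b, k) \<in> r)"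
    unfolding cofinal_def by blast
  have "(k, b) \<in> r" if k: "k \<in> K" for k
  proof (cases "b = k")
    case True
    then show ?thesis
      using b(1) Cinfinite_linear_order[OF r] by (simp add: order_on_defs refl_on_def)
  next
    case False
    moreover have "(b, k) \<notin> r" using b(2)[OF k] False by simp
    moreover have "k \<in> Field r" using K k by auto
    ultimately show ?thesis
      using b(1) Cinfinite_linear_order[OF r] by (auto simp: order_on_defs total_on_def)
  qed
  with b(1) show thesis using that by blast
qed

lemma finite_subset_bounded:
  assumes r: "Linear_order r" and "finite F" "F \<subseteq> Field r" "Field r \<noteq> {}"
  obtains b where "b \<in> Field r" "F \<subseteq> under r b"
proof -
  have "\<exists>b\<in>Field r. F \<subseteq> under r b"
    using assms(2,3)
  proof (induction F rule: finite_induct)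
    case empty
    then show ?case using assms(4) by blast
  next
    case (insert x F)
    then obtain b where b: "b \<in> Field r" "F \<subseteq> under r b" by blast
    have x: "x \<in> Field r" using insert by blast
    have refl: "(x, x) \<in> r" "(b, b) \<in> r"
      using x b r unfolding order_on_defs refl_on_def by blast+
    show ?case
    proof (cases "(x, b) \<in> r")
      case True
      then show ?thesis using b by (auto simp: under_def)
    next
      case False
      then have "(b, x) \<in> r" using x b refl r unfolding order_on_defs total_on_def by metis
      then have "F \<subseteq> under r x"
        using b r under_incr[of r b x] unfolding order_on_defs by blast
      then show ?thesis using x refl by (auto simp: under_def)
    qed
  qed
  with that show thesis by blast
qed

section \<open>The topology of traces on initial segments\<close>

text \<open>
  The points are coded injectively by sets \<open>c x\<close> of items, and each item has a rank in \<open>r\<close>.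
  Two points are close if their codes contain the same items of small rank. The points are kept
  apart from their codes so that the space can live on \<open>Field r\<close> itself.
\<close>

locale trace_space =
  fixes r :: "'i rel" and rk :: "'p \<Rightarrow> 'i" and S :: "'b set" and c :: "'b \<Rightarrow> 'p set"
  assumes Cinf: "Cinfinite r"
    and inj: "inj_on c S"
    and rank: "\<And>x p. x \<in> S \<Longrightarrow> p \<in> c x \<Longrightarrow> rk p \<in> Field r"
begin

definition trace :: "'i \<Rightarrow> 'b \<Rightarrow> 'p set" where
  "trace \<alpha> x = {p \<in> c x. rk p \<in> under r \<alpha>}"

definition cell :: "'i \<Rightarrow> 'b \<Rightarrow> 'b set" where
  "cell \<alpha> x = {y \<in> S. trace \<alpha> y = trace \<alpha> x}"

definition trace_topology :: "'b topology" where
  "trace_topology = topology (\<lambda>U. U \<subseteq> S \<and> (\<forall>x\<in>U. \<exists>\<alpha>\<in>Field r. cell \<alpha> x \<subseteq> U))"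

lemma linear: "Linear_order r"
  using Cinf by (rule Cinfinite_linear_order)

lemma Field_nonempty: "Field r \<noteq> {}"
  using Cinf by (auto simp: cinfinite_def)

lemma cell_self: "x \<in> S \<Longrightarrow> x \<in> cell \<alpha> x"
  by (simp add: cell_def)

lemma cell_mono:
  assumes "(\<alpha>, \<beta>) \<in> r"
  shows "cell \<beta> x \<subseteq> cell \<alpha> x"
proof -
  have "trans r" using linear by (simp add: order_on_defs)
  then have "under r \<alpha> \<subseteq> under r \<beta>" using assms by (rule under_incr)
  then have sub: "trace \<alpha> y = {p \<in> trace \<beta> y. rk p \<in> under r \<alpha>}" for y
    unfolding trace_def by blast
  show ?thesis
  proof
    fix y assume "y \<in> cell \<beta> x"
    then have "y \<in> S" "trace \<beta> y = trace \<beta> x" by (simp_all add: cell_def)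
    then show "y \<in> cell \<alpha> x" using sub[of x] sub[of y] by (simp add: cell_def)
  qed
qed

lemma Field_upper_bound:
  assumes "\<alpha> \<in> Field r" "\<beta> \<in> Field r"
  obtains \<gamma> where "\<gamma> \<in> Field r" "(\<alpha>, \<gamma>) \<in> r" "(\<beta>, \<gamma>) \<in> r"
proof -
  obtain \<gamma> where "\<gamma> \<in> Field r" "{\<alpha>, \<beta>} \<subseteq> under r \<gamma>"
    using finite_subset_bounded[OF linear, of "{\<alpha>, \<beta>}"] assms Field_nonempty by auto
  then show thesis using that by (simp add: under_def)
qed

lemma openin_trace_topology:
  "openin trace_topology U \<longleftrightarrow> U \<subseteq> S \<and> (\<forall>x\<in>U. \<exists>\<alpha>\<in>Field r. cell \<alpha> x \<subseteq> U)"
proof -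
  have "istopology (\<lambda>U. U \<subseteq> S \<and> (\<forall>x\<in>U. \<exists>\<alpha>\<in>Field r. cell \<alpha> x \<subseteq> U))"
    unfolding istopology_def
  proof (intro conjI allI impI ballI)
    fix U V x
    assume U: "U \<subseteq> S \<and> (\<forall>x\<in>U. \<exists>\<alpha>\<in>Field r. cell \<alpha> x \<subseteq> U)"
      and V: "V \<subseteq> S \<and> (\<forall>x\<in>V. \<exists>\<alpha>\<in>Field r. cell \<alpha> x \<subseteq> V)" and x: "x \<in> U \<inter> V"
    obtain \<alpha> where \<alpha>: "\<alpha> \<in> Field r" "cell \<alpha> x \<subseteq> U"
      using U x by (meson IntD1)
    obtain \<beta> where \<beta>: "\<beta> \<in> Field r" "cell \<beta> x \<subseteq> V"
      using V x by (meson IntD2)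
    obtain \<gamma> where \<gamma>: "\<gamma> \<in> Field r" "(\<alpha>, \<gamma>) \<in> r" "(\<beta>, \<gamma>) \<in> r"
      using Field_upper_bound[OF \<alpha>(1) \<beta>(1)] .
    have "cell \<gamma> x \<subseteq> U \<inter> V"
      using cell_mono[OF \<gamma>(2), of x] cell_mono[OF \<gamma>(3), of x] \<alpha>(2) \<beta>(2)
      by (meson Int_greatest order_trans)
    with \<gamma>(1) show "\<exists>\<gamma>\<in>Field r. cell \<gamma> x \<subseteq> U \<inter> V" by (rule bexI[rotated])
  next
    fix \<K> x
    assume K: "\<forall>U\<in>\<K>. U \<subseteq> S \<and> (\<forall>x\<in>U. \<exists>\<alpha>\<in>Field r. cell \<alpha> x \<subseteq> U)" and "x \<in> \<Union>\<K>"
    then obtain U where U: "U \<in> \<K>" "x \<in> U" by auto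
    then obtain \<alpha> where "\<alpha> \<in> Field r" "cell \<alpha> x \<subseteq> U" using K by metis
    with U show "\<exists>\<alpha>\<in>Field r. cell \<alpha> x \<subseteq> \<Union>\<K>" by auto
  qed (simp_all add: le_infI1 Sup_le_iff)
  from fun_cong[OF topology_inverse'[OF this], of U] show ?thesis
    unfolding trace_topology_def .
qed

lemma cell_subset: "cell \<alpha> x \<subseteq> S"
  by (auto simp: cell_def)

lemma topspace_trace_topology: "topspace trace_topology = S"
proof (rule subset_antisym)
  have "openin trace_topology S"
    unfolding openin_trace_topology using Field_nonempty cell_subset by blast
  then show "S \<subseteq> topspace trace_topology" by (rule openin_subset)
  show "topspace trace_topology \<subseteq> S"
    by (rule conjunct1[OF iffD1[OF openin_trace_topology openin_topspace]])
qed

lemma openin_cell: "\<alpha> \<in> Field r \<Longrightarrow> openin trace_topology (cell \<alpha> x)"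
  unfolding openin_trace_topology by (auto simp: cell_def intro!: bexI[of _ \<alpha>])

lemma closedin_cell:
  assumes "\<alpha> \<in> Field r"
  shows "closedin trace_topology (cell \<alpha> x)"
  unfolding closedin_def topspace_trace_topology openin_trace_topology
  using assms by (auto simp: cell_def intro!: bexI[of _ \<alpha>])

lemma closed_nbhd_cell: "\<alpha> \<in> Field r \<Longrightarrow> x \<in> S \<Longrightarrow> closed_nbhd trace_topology x (cell \<alpha> x)"
  by (simp add: closed_nbhd_def closedin_cell openin_cell cell_self interior_of_openin)

lemma closed_nbhd_contains_cell:
  assumes "closed_nbhd trace_topology x U"
  obtains \<alpha> where "\<alpha> \<in> Field r" "cell \<alpha> x \<subseteq> U"
proof -
  have "openin trace_topology (trace_topology interior_of U)" "x \<in> trace_topology interior_of U"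
    using assms by (auto simp: closed_nbhd_def)
  then obtain \<alpha> where "\<alpha> \<in> Field r" "cell \<alpha> x \<subseteq> trace_topology interior_of U"
    unfolding openin_trace_topology by metis
  with interior_of_subset[of trace_topology U] show thesis
    by (intro that[of \<alpha>]) auto
qed

lemma trace_neq_above_rank:
  assumes "x \<in> S" "y \<in> S" "x \<noteq> y"
  obtains \<delta> where "\<delta> \<in> Field r" "\<And>\<alpha>. (\<delta>, \<alpha>) \<in> r \<Longrightarrow> trace \<alpha> x \<noteq> trace \<alpha> y"
proof -
  have "c x \<noteq> c y" using assms inj by (auto dest: inj_onD)
  then obtain p where p: "p \<in> c x \<longleftrightarrow> p \<notin> c y" by blast
  then have "rk p \<in> Field r" using assms rank by blast
  moreover have "trace \<alpha> x \<noteq> trace \<alpha> y" if "(rk p, \<alpha>) \<in> r" for \<alpha>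
    using p that by (auto simp: trace_def under_def)
  ultimately show thesis using that by blast
qed

lemma Hausdorff: "Hausdorff_space trace_topology"
  unfolding Hausdorff_space_def topspace_trace_topology
proof (intro allI impI)
  fix x y assume xy: "x \<in> S \<and> y \<in> S \<and> x \<noteq> y"
  then obtain \<delta> where d: "\<delta> \<in> Field r" "\<And>\<alpha>. (\<delta>, \<alpha>) \<in> r \<Longrightarrow> trace \<alpha> x \<noteq> trace \<alpha> y"
    using trace_neq_above_rank by blast
  then have "(\<delta>, \<delta>) \<in> r" using linear unfolding order_on_defs refl_on_def by blast
  from d(2)[OF this] have "z \<notin> cell \<delta> y" if "z \<in> cell \<delta> x" for z
    using that by (simp add: cell_def)
  then have "disjnt (cell \<delta> x) (cell \<delta> y)" by (simp add: disjnt_iff)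
  then show "\<exists>U V. openin trace_topology U \<and> openin trace_topology V \<and>
      x \<in> U \<and> y \<in> V \<and> disjnt U V"
    using openin_cell[OF d(1)] cell_self xy by metis
qed

lemma zero_dimensional: "zero_dimensional_space trace_topology"
  unfolding zero_dimensional_space_def
proof (intro exI conjI ballI)
  let ?B = "{cell \<alpha> x | \<alpha> x. \<alpha> \<in> Field r \<and> x \<in> S}"
  fix B assume "B \<in> ?B"
  then show "openin trace_topology B" "closedin trace_topology B" using openin_cell closedin_cell by auto
next
  let ?B = "{cell \<alpha> x | \<alpha> x. \<alpha> \<in> Field r \<and> x \<in> S}"
  show "openin trace_topology = arbitrary union_of (\<lambda>B. B \<in> ?B)"
  proof (subst openin_topology_base_unique, intro conjI allI impI)
    fix V assume "V \<in> ?B"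
    then show "openin trace_topology V" using openin_cell by auto
  next
    fix U x assume U: "openin trace_topology U \<and> x \<in> U"
    then obtain \<alpha> where "\<alpha> \<in> Field r" "cell \<alpha> x \<subseteq> U" "x \<in> S"
      unfolding openin_trace_topology by blast
    then show "\<exists>V. V \<in> ?B \<and> x \<in> V \<and> V \<subseteq> U"
      using cell_self by blast
  qed
qed

lemma closed_pseudocharacter_le_cofinality: "closed_pseudocharacter_le trace_topology (cofinality r)"
  unfolding closed_pseudocharacter_le_def topspace_trace_topology
proof
  fix x assume x: "x \<in> S"
  obtain K where K: "K \<subseteq> Field r" "cofinal K r" "|K| =o cofinality r"
    using cofinality(2)[OF Cinf] by blast
  let ?\<U> = "(\<lambda>k. cell k x) ` K"
  have "y = x" if y: "y \<in> S" "y \<in> \<Inter>?\<U>" for y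
  proof (rule ccontr)
    assume "y \<noteq> x"
    then obtain \<delta> where d: "\<delta> \<in> Field r" "\<And>\<alpha>. (\<delta>, \<alpha>) \<in> r \<Longrightarrow> trace \<alpha> y \<noteq> trace \<alpha> x"
      using trace_neq_above_rank x y by blast
    then obtain k where k: "k \<in> K" "(\<delta>, k) \<in> r" using K(2) unfolding cofinal_def by blast
    then have "y \<in> cell k x" using y by blast
    with d(2)[OF k(2)] show False by (simp add: cell_def)
  qed
  then have "S \<inter> \<Inter>?\<U> = {x}" using x cell_self by blast
  moreover have "|?\<U>| \<le>o cofinality r"
    using card_of_image ordLeq_ordIso_trans K(3) by blast
  moreover have "\<forall>U\<in>?\<U>. closed_nbhd trace_topology x U" using closed_nbhd_cell K(1) x by blast
  ultimately show "\<exists>\<U>. (\<forall>U\<in>\<U>. closed_nbhd trace_topology x U) \<and> |\<U>| \<le>o cofinality r \<and>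
      S \<inter> \<Inter>\<U> = {x}" by blast
qed

end

section \<open>The semilattice of finite partial functions\<close>

text \<open>
  Partial functions are represented by their graphs. The zero element is represented by the full
  set \<open>A \<times> UNIV\<close>, so that multiplication is union followed by a closure operator.
\<close>

definition collapse :: "'a set \<Rightarrow> ('a \<times> bool) set \<Rightarrow> ('a \<times> bool) set" where
  "collapse A f = (if single_valued f then f else A \<times> UNIV)"

definition finite_partial_functions :: "'a set \<Rightarrow> ('a \<times> bool) set set" where
  "finite_partial_functions A = {f. finite f \<and> single_valued f \<and> f \<subseteq> A \<times> UNIV}"

definition partial_functions_zero :: "'a set \<Rightarrow> ('a \<times> bool) set set" where
  "partial_functions_zero A = insert (A \<times> UNIV) (finite_partial_functions A)"

lemma not_single_valued_Times: "A \<noteq> {} \<Longrightarrow> \<not> single_valued (A \<times> (UNIV :: bool set))"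
  by (auto simp: single_valued_def)

lemma collapse_Un_collapse:
  assumes "f \<subseteq> A \<times> UNIV" "g \<subseteq> A \<times> UNIV"
  shows "collapse A (collapse A f \<union> g) = collapse A (f \<union> g)"
proof (cases "single_valued f")
  case False
  then have "A \<noteq> {}" using assms by (auto simp: single_valued_def)
  moreover have "\<not> single_valued (f \<union> g)"
    using False single_valued_subset[of f "f \<union> g"] by blast
  moreover have "A \<times> UNIV \<union> g = A \<times> UNIV" using assms by blast
  ultimately show ?thesis
    using False not_single_valued_Times[of A] by (simp add: collapse_def)
qed (simp add: collapse_def)

lemma partial_functions_zero_subset: "f \<in> partial_functions_zero A \<Longrightarrow> f \<subseteq> A \<times> UNIV"
  by (auto simp: partial_functions_zero_def finite_partial_functions_def)

lemma collapse_partial_functions_zero: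
  assumes "A \<noteq> {}" "f \<in> partial_functions_zero A"
  shows "collapse A f = f"
  using assms by (auto simp: partial_functions_zero_def finite_partial_functions_def collapse_def)

lemma collapse_Un_in_partial_functions_zero:
  assumes "A \<noteq> {}" "f \<in> partial_functions_zero A" "g \<in> partial_functions_zero A"
  shows "collapse A (f \<union> g) \<in> partial_functions_zero A"
proof (cases "single_valued (f \<union> g)")
  case True
  then have "f \<noteq> A \<times> UNIV" "g \<noteq> A \<times> UNIV"
    using not_single_valued_Times[OF assms(1)] single_valued_subset[of _ "f \<union> g"] by blast+
  with True assms show ?thesis
    by (auto simp: partial_functions_zero_def finite_partial_functions_def collapse_def)
qed (simp add: partial_functions_zero_def collapse_def)

lemma card_finite_subsets:
  fixes B :: "'b set"
  assumes "infinite B"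
  shows "|{f. finite f \<and> f \<subseteq> B}| \<le>o |B|"
proof -
  let ?F = "\<lambda>n. {f. finite f \<and> f \<subseteq> B \<and> card f = n}"
  have F: "|?F n| \<le>o |B|" for n
  proof (induction n)
    case 0
    have "?F 0 = {{}}" by auto
    then show ?case using assms card_of_singl_ordLeq[of B "{}"] by fastforce
  next
    case (Suc n)
    have "?F (Suc n) \<subseteq> (\<lambda>(x, f). insert x f) ` (B \<times> ?F n)"
    proof
      fix g assume g: "g \<in> ?F (Suc n)"
      then obtain x f where "g = insert x f" "x \<notin> f" "card f = n"
        by (auto simp: card_Suc_eq)
      with g show "g \<in> (\<lambda>(x, f). insert x f) ` (B \<times> ?F n)"
        by (intro image_eqI[of _ _ "(x, f)"]) auto
    qed
    then have "|?F (Suc n)| \<le>o |(\<lambda>(x, f). insert x f) ` (B \<times> ?F n)|" by (rule card_of_mono1)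
    also have "|(\<lambda>(x, f). insert x f) ` (B \<times> ?F n)| \<le>o |B \<times> ?F n|" by (rule card_of_image)
    also have "|B \<times> ?F n| \<le>o |B|"
      using assms Suc card_of_Card_order[of B] ordLeq_refl[OF card_of_Card_order[of B]]
      by (intro card_of_Times_ordLeq_infinite_Field) (simp_all add: Field_card_of)
    finally show ?case .
  qed
  have "{f. finite f \<and> f \<subseteq> B} = (\<Union>n. ?F n)" by (simp add: set_eq_iff)
  moreover have "|\<Union>n. ?F n| \<le>o |B|"
  proof (rule card_of_UNION_ordLeq_infinite[OF assms])
    show "|UNIV :: nat set| \<le>o |B|" using assms by (simp flip: infinite_iff_card_of_nat)
    show "\<forall>n\<in>UNIV. |?F n| \<le>o |B|" using F by (intro ballI)
  qed
  ultimately show ?thesis by simp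
qed

lemma card_partial_functions_zero:
  fixes A :: "'a set"
  assumes "infinite A"
  shows "|partial_functions_zero A| =o |A|"
proof -
  let ?Z = "A \<times> (UNIV :: bool set)"
  let ?F = "{f. finite f \<and> f \<subseteq> ?Z}"
  have infZ: "infinite ?Z" using assms by (auto simp: finite_cartesian_product_iff)
  have "|UNIV :: bool set| \<le>o |A|"
    by (rule ordLess_imp_ordLeq[OF finite_ordLess_infinite]) (use assms in \<open>simp_all add: card_of_well_order_on Field_card_of\<close>)
  then have Z: "|?Z| =o |A|"
    using card_of_Times_infinite[OF assms, of "UNIV :: bool set"] by simp
  have "partial_functions_zero A \<subseteq> {?Z} \<union> ?F"
    by (auto simp: partial_functions_zero_def finite_partial_functions_def)
  then have "|partial_functions_zero A| \<le>o |{?Z} \<union> ?F|" by (rule card_of_mono1)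
  also have "|{?Z} \<union> ?F| \<le>o |?Z|"
  proof (rule card_of_Un_ordLeq_infinite_Field)
    show "|{?Z}| \<le>o |?Z|" by (rule card_of_singl_ordLeq) (use infZ in auto)
    show "|?F| \<le>o |?Z|" by (rule card_finite_subsets[OF infZ])
  qed (use infZ in \<open>simp_all add: card_of_card_order_on Field_card_of\<close>)
  also note Z
  finally have upper: "|partial_functions_zero A| \<le>o |A|" .
  have "(\<lambda>a. {(a, True)}) ` A \<subseteq> partial_functions_zero A"
    by (auto simp: partial_functions_zero_def finite_partial_functions_def single_valued_def)
  moreover have "inj_on (\<lambda>a. {(a, True)}) A" by (simp add: inj_on_def)
  ultimately have "|A| \<le>o |partial_functions_zero A|"
    unfolding card_of_ordLeq[symmetric] by (intro exI conjI)
  with upper show ?thesis by (simp add: ordIso_iff_ordLeq)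
qed

locale partial_function_semilattice =
  fixes r :: "'i rel" and S :: "'b set" and c :: "'b \<Rightarrow> ('i \<times> bool) set"
  assumes Cinfinite: "Cinfinite r"
    and bij: "bij_betw c S (partial_functions_zero (Field r))"
begin

sublocale trace_space r fst S c
proof
  show "Cinfinite r" by (rule Cinfinite)
  show "inj_on c S" using bij by (simp add: bij_betw_def)
  fix x p assume "x \<in> S" "p \<in> c x"
  moreover from this have "c x \<in> partial_functions_zero (Field r)"
    using bij by (auto simp: bij_betw_def)
  ultimately show "fst p \<in> Field r"
    using partial_functions_zero_subset by fastforce
qed

definition mult :: "'b \<Rightarrow> 'b \<Rightarrow> 'b" where
  "mult x y = inv_into S c (collapse (Field r) (c x \<union> c y))"

lemma code: "x \<in> S \<Longrightarrow> c x \<in> partial_functions_zero (Field r)"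
  using bij by (auto simp: bij_betw_def)

lemma code_subset: "x \<in> S \<Longrightarrow> c x \<subseteq> Field r \<times> UNIV"
  by (rule partial_functions_zero_subset[OF code])

lemma collapse_in_code_image:
  assumes "x \<in> S" "y \<in> S"
  shows "collapse (Field r) (c x \<union> c y) \<in> c ` S"
  using collapse_Un_in_partial_functions_zero[OF Field_nonempty code code] assms bij
  by (simp add: bij_betw_def)

lemma mult_in: "x \<in> S \<Longrightarrow> y \<in> S \<Longrightarrow> mult x y \<in> S"
  unfolding mult_def by (intro inv_into_into collapse_in_code_image)

lemma code_mult: "x \<in> S \<Longrightarrow> y \<in> S \<Longrightarrow> c (mult x y) = collapse (Field r) (c x \<union> c y)"
  unfolding mult_def by (intro f_inv_into_f collapse_in_code_image)

lemma code_eqD: "x \<in> S \<Longrightarrow> y \<in> S \<Longrightarrow> c x = c y \<Longrightarrow> x = y"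
  using inj by (auto dest: inj_onD)

lemma mult_commute: "mult x y = mult y x"
  by (simp add: mult_def Un_commute)

lemma semilattice: "semilattice_on S mult"
  unfolding semilattice_on_def
proof (intro conjI ballI)
  fix x y z assume xyz: "x \<in> S" "y \<in> S" "z \<in> S"
  have code3: "c (mult (mult u v) w) = collapse (Field r) (c u \<union> c v \<union> c w)"
    if "u \<in> S" "v \<in> S" "w \<in> S" for u v w
    using that by (simp add: code_mult mult_in collapse_Un_collapse code_subset)
  have "c (mult (mult x y) z) = collapse (Field r) (c y \<union> c z \<union> c x)"
    using code3[OF xyz] by (simp add: Un_ac)
  also have "\<dots> = c (mult (mult y z) x)"
    using code3[OF xyz(2,3,1)] by simp
  finally show "mult (mult x y) z = mult x (mult y z)"
    using xyz by (metis code_eqD mult_in mult_commute)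
next
  fix x assume "x \<in> S"
  then show "mult x x = x"
    by (intro code_eqD) (simp_all add: code_mult mult_in collapse_partial_functions_zero
        Field_nonempty code)
qed (simp_all add: mult_in mult_commute)

text \<open>
  Every initial segment \<open>under r \<alpha>\<close> contains \<open>\<alpha>\<close>, where the trace of the zero element already
  fails to be a partial function. This is why zero is an isolated point.
\<close>

lemma cell_zero:
  assumes "\<alpha> \<in> Field r" "y \<in> cell \<alpha> x" "x \<in> S" "c x = Field r \<times> UNIV"
  shows "c y = Field r \<times> UNIV"
proof -
  have "(\<alpha>, \<alpha>) \<in> r" using linear assms(1) unfolding order_on_defs refl_on_def by blast
  then have "{\<alpha>} \<times> UNIV \<subseteq> trace \<alpha> x" using assms by (auto simp: trace_def under_def)
  also have "\<dots> \<subseteq> c y" using assms(2) by (auto simp: cell_def trace_def)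
  finally have "\<not> single_valued (c y)"
    using not_single_valued_Times[of "{\<alpha>}"] single_valued_subset by blast
  moreover have "y \<in> S" using assms(2) by (simp add: cell_def)
  ultimately show ?thesis
    using code[of y] by (auto simp: partial_functions_zero_def finite_partial_functions_def)
qed

text \<open>
  The threshold \<open>\<alpha>\<close> bounds the domains of \<open>x\<close> and \<open>a\<close>. Beyond it \<open>y\<close> may differ from \<open>x\<close>,
  but there the factor \<open>a\<close> is undefined, so no new conflict can arise.
\<close>

lemma mult_cell:
  assumes a: "a \<in> S" and x: "x \<in> S" and \<beta>: "\<beta> \<in> Field r"
  obtains \<alpha> where "\<alpha> \<in> Field r" "\<And>y. y \<in> cell \<alpha> x \<Longrightarrow> mult a y \<in> cell \<beta> (mult a x)"
proof -
  let ?Z = "Field r \<times> (UNIV :: bool set)"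
  note nsv = not_single_valued_Times[OF Field_nonempty]
  consider (x_zero) "c x = ?Z" | (a_zero) "c a = ?Z"
    | (finite) "c x \<in> finite_partial_functions (Field r)" "c a \<in> finite_partial_functions (Field r)"
    using code[OF a] code[OF x] by (auto simp: partial_functions_zero_def)
  then show thesis
  proof cases
    case x_zero
    have "y = x" if "y \<in> cell \<beta> x" for y
      using cell_zero[OF \<beta> that x x_zero] x_zero that x code_eqD[of y x] by (auto simp: cell_def)
    then show thesis using that[OF \<beta>] mult_in[OF a x] cell_self by metis
  next
    case a_zero
    have zero: "c (mult a y) = ?Z" if "y \<in> S" for y
      using that a a_zero nsv code_subset[OF that]
      by (simp add: code_mult collapse_def Un_absorb2)
    have "mult a y = mult a x" if "y \<in> cell \<beta> x" for y
      using that zero a x mult_in code_eqD[of "mult a y" "mult a x"] by (auto simp: cell_def)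
    then show thesis using that[OF \<beta>] mult_in[OF a x] cell_self by metis
  next
    case finite
    let ?F = "insert \<beta> (fst ` (c x \<union> c a))"
    have "finite ?F" "?F \<subseteq> Field r"
      using finite \<beta> by (auto simp: finite_partial_functions_def)
    then obtain \<alpha> where \<alpha>: "\<alpha> \<in> Field r" "?F \<subseteq> under r \<alpha>"
      using finite_subset_bounded[OF linear _ _ Field_nonempty] by blast
    have "mult a y \<in> cell \<beta> (mult a x)" if y: "y \<in> cell \<alpha> x" for y
    proof -
      have yS: "y \<in> S" and tr: "trace \<alpha> y = c x"
        using y \<alpha> by (auto simp: cell_def trace_def)
      then have sub: "c x \<subseteq> c y" by (auto simp: trace_def)
      have tail: "p \<in> c x \<or> fst p \<notin> under r \<alpha>" if "p \<in> c y" for p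
        using that tr by (auto simp: trace_def)
      have "mult a y \<in> cell \<alpha> (mult a x)"
      proof (cases "single_valued (c a \<union> c x)")
        case False
        then have "\<not> single_valued (c a \<union> c y)"
          using sub single_valued_subset[of "c a \<union> c x" "c a \<union> c y"] by blast
        with False show ?thesis
          using a x yS mult_in by (simp add: cell_def trace_def code_mult collapse_def)
      next
        case True
        have "c y \<noteq> ?Z"
        proof
          assume "c y = ?Z"
          moreover have "x \<in> cell \<alpha> y" using y x by (simp add: cell_def)
          ultimately have "c x = ?Z" using cell_zero \<alpha>(1) yS by blast
          then show False using finite nsv by (simp add: finite_partial_functions_def)
        qed
        then have "single_valued (c y)"
          using code[OF yS] by (auto simp: partial_functions_zero_def finite_partial_functions_def)
        then have "single_valued (c a \<union> c y)"
          using True tail \<alpha>(2) unfolding single_valued_def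
          by (smt (verit, ccfv_threshold) Un_iff fst_conv image_subset_iff insert_subset)
        moreover have "{p \<in> c a \<union> c y. fst p \<in> under r \<alpha>} = {p \<in> c a \<union> c x. fst p \<in> under r \<alpha>}"
          using sub tail by blast
        ultimately show ?thesis
          using True a x yS mult_in by (simp add: cell_def trace_def code_mult collapse_def)
      qed
      moreover have "(\<beta>, \<alpha>) \<in> r" using \<alpha>(2) by (simp add: under_def)
      ultimately show ?thesis using cell_mono by blast
    qed
    with \<alpha>(1) show thesis using that by blast
  qed
qed

lemma semitopological: "semitopological_semilattice trace_topology mult"
proof -
  have "continuous_map trace_topology trace_topology (mult a)" if a: "a \<in> S" for a
    unfolding continuous_map_def topspace_trace_topology
  proof (intro conjI allI impI)
    show "mult a \<in> S \<rightarrow> S" using mult_in a by blast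
    fix U assume U: "openin trace_topology U"
    show "openin trace_topology {x \<in> S. mult a x \<in> U}"
      unfolding openin_trace_topology
    proof (intro conjI ballI)
      fix x assume x: "x \<in> {x \<in> S. mult a x \<in> U}"
      then obtain \<beta> where b: "\<beta> \<in> Field r" "cell \<beta> (mult a x) \<subseteq> U"
        using U unfolding openin_trace_topology by blast
      obtain \<alpha> where "\<alpha> \<in> Field r" "\<And>y. y \<in> cell \<alpha> x \<Longrightarrow> mult a y \<in> cell \<beta> (mult a x)"
        using mult_cell[OF a _ b(1), of x] x by blast
      then show "\<exists>\<alpha>\<in>Field r. cell \<alpha> x \<subseteq> {x \<in> S. mult a x \<in> U}"
        using b(2) by (intro bexI[of _ \<alpha>]) (auto simp: cell_def)
    qed blast
  qed
  moreover have "(\<lambda>x. mult x a) = mult a" for a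
    by (simp add: fun_eq_iff mult_commute)
  ultimately show ?thesis
    unfolding semitopological_semilattice_def topspace_trace_topology
    using semilattice by (simp add: eta_contract_eq)
qed

lemma cofinality_le_Lawson:
  assumes \<kappa>: "Card_order \<kappa>" and Lawson: "Lawson_le trace_topology mult \<kappa>"
  shows "cofinality r \<le>o \<kappa>"
proof (rule ccontr)
  assume "\<not> cofinality r \<le>o \<kappa>"
  then have small: "\<kappa> <o cofinality r"
    using not_ordLeq_iff_ordLess[OF card_order_on_well_order_on[OF \<kappa>]
        card_order_on_well_order_on[OF cofinality(1)[OF Cinfinite]]] by simp
  have code_surj: "\<exists>x\<in>S. c x = f" if "f \<in> partial_functions_zero (Field r)" for f
    using that bij_betw_imp_surj_on[OF bij] by (metis imageE)
  obtain e z where e: "e \<in> S" "c e = {}" and z: "z \<in> S" "c z = Field r \<times> UNIV"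
    using code_surj[of "{}"] code_surj[of "Field r \<times> UNIV"]
    by (auto simp: partial_functions_zero_def finite_partial_functions_def)
  have "e \<noteq> z" using e z Field_nonempty by auto
  then obtain \<U> where \<U>: "\<And>U. U \<in> \<U> \<Longrightarrow> closed_nbhd trace_topology e U" "|\<U>| \<le>o \<kappa>"
    and sub: "subsemilattice (S \<inter> \<Inter>\<U>) S mult" and notin: "z \<notin> S \<inter> \<Inter>\<U>"
    using Lawson e z unfolding Lawson_le_def topspace_trace_topology by metis
  have "\<exists>\<alpha>. \<alpha> \<in> Field r \<and> cell \<alpha> e \<subseteq> U" if "U \<in> \<U>" for U
    using closed_nbhd_contains_cell[OF \<U>(1)[OF that]] by metis
  then obtain t where t: "\<And>U. U \<in> \<U> \<Longrightarrow> t U \<in> Field r \<and> cell (t U) e \<subseteq> U"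
    by metis
  have "t ` \<U> \<subseteq> Field r" using t by auto
  moreover have "|t ` \<U>| <o cofinality r"
    by (rule ordLeq_ordLess_trans[OF ordLeq_transitive[OF card_of_image \<U>(2)] small])
  ultimately obtain b where b: "b \<in> Field r" and bound: "\<And>k. k \<in> t ` \<U> \<Longrightarrow> (k, b) \<in> r"
    using small_subset_bounded[OF Cinfinite] by blast
  \<comment> \<open>Strictly above \<open>b\<close>, both one-point functions at \<open>\<gamma>\<close> have empty trace at \<open>b\<close>.\<close>
  obtain \<gamma> where \<gamma>: "\<gamma> \<in> Field r" "b \<noteq> \<gamma>" "(b, \<gamma>) \<in> r"
    using Cinfinite_greater_exists[OF Cinfinite b] .
  obtain p where p: "\<And>v. p v \<in> S \<and> c (p v) = {(\<gamma>, v)}"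
  proof -
    have "{(\<gamma>, v)} \<in> partial_functions_zero (Field r)" for v
      using \<gamma>(1) by (auto simp: partial_functions_zero_def finite_partial_functions_def
          single_valued_def)
    then have "\<forall>v. \<exists>x. x \<in> S \<and> c x = {(\<gamma>, v)}" using code_surj by blast
    then show thesis using that by metis
  qed
  have "(\<gamma>, b) \<notin> r"
    using \<gamma> linear unfolding order_on_defs antisym_def by blast
  then have "p v \<in> cell b e" for v
    using p e by (auto simp: cell_def trace_def under_def)
  then have mem: "p v \<in> S \<inter> \<Inter>\<U>" for v
    using t cell_mono[OF bound[OF imageI]] p by (meson IntI InterI subsetD)
  have "(\<gamma>, v) \<in> c (p True) \<union> c (p False)" for v
    using p by (cases v) simp_all
  then have "\<not> single_valued (c (p True) \<union> c (p False))"
    unfolding single_valued_def by metis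
  then have "c (mult (p True) (p False)) = Field r \<times> UNIV"
    using p by (simp add: code_mult collapse_def)
  then have "mult (p True) (p False) = z"
    using p z mult_in code_eqD by metis
  then have "z \<in> S \<inter> \<Inter>\<U>" using sub mem unfolding subsemilattice_def by metis
  with notin show False by blast
qed

end

theorem mainTheorem5:
  fixes r :: "'a rel"
  assumes "Cinfinite r"
  shows "\<exists>(T :: 'a topology) m.
           semitopological_semilattice T m \<and>
           Hausdorff_space T \<and>
           zero_dimensional_space T \<and>
           |topspace T| =o r \<and>
           Lawson_number T m =o cofinality r \<and>
           closed_pseudocharacter T =o cofinality r"
proof -
  have "infinite (Field r)" using assms by (simp add: cinfinite_def)
  from card_partial_functions_zero[OF this]
  have "|Field r| =o |partial_functions_zero (Field r)|" by (rule ordIso_symmetric)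
  then obtain c where "bij_betw c (Field r) (partial_functions_zero (Field r))"
    using card_of_ordIso by blast
  then interpret partial_function_semilattice r "Field r" c
    using assms by unfold_locales
  note L = Lawson_number[OF Hausdorff, unfolded topspace_trace_topology, OF semilattice]
  note P = closed_pseudocharacter[OF Hausdorff]
  have "cofinality r \<le>o Lawson_number trace_topology mult"
    using cofinality_le_Lawson L(1,2) by blast
  moreover have "Lawson_number trace_topology mult \<le>o closed_pseudocharacter trace_topology"
    using L(3) P(1,2) closed_pseudocharacter_le_imp_Lawson_le semilattice topspace_trace_topology by metis
  moreover have "closed_pseudocharacter trace_topology \<le>o cofinality r"
    using P(3) cofinality(1)[OF assms] closed_pseudocharacter_le_cofinality by blast
  ultimately have "Lawson_number trace_topology mult =o cofinality r"
    "closed_pseudocharacter trace_topology =o cofinality r"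
    unfolding ordIso_iff_ordLeq by (meson ordLeq_transitive)+
  moreover have "|topspace trace_topology| =o r"
    unfolding topspace_trace_topology using assms card_of_Field_ordIso by blast
  ultimately show ?thesis
    using semitopological Hausdorff zero_dimensional by blast
qed

end
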